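(* Let $(A,\cdot,[-,-],P)$ be a relative Poisson algebra with an invariant-c2c form $\mathcal{B}$. Define a binary operation $\circ$ on $A$ and a linear map $\hat P:A\to A$ by $$\mathcal{B}(x\circ y,z)=\mathcal{B}(y,[x,z]),\qquad \mathcal{B}\big(\hat{P}(x),y\big)=\mathcal{B}\big(x,P(y)\big),\qquad\forall x,y,z\in A.$$ Then $(A,\cdot,\circ,P,\hat{P})$ is a relative PCA algebra.
   Context: All vector spaces are finite-dimensional over an algebraically closed field $\mathbb K$ of characteristic zero. A relative Poisson algebra is a quadruple $(A,\cdot,[-,-],P)$ where $(A,\cdot)$ is a commutative associative algebra, $(A,[-,-])$ is a Lie algebra, $P$ is a derivation of both $(A,\cdot)$ and $(A,[-,-])$, and $[z,x\cdot y]=[z,x]\cdot y+x\cdot[z,y]+x\cdot y\cdot P(z)$ for all $x,y,z\in A$. An invariant-c2c form on a relative Poisson algebra $(A,\cdot,[-,-],P)$ is a nondegenerate symmetric bilinear form $\mathcal B$ on $A$ such that $\mathcal B(x\cdot y,z)=\mathcal B(x,y\cdot z)$ (invariance on $(A,\cdot)$) and $\mathcal{B}([x,y],z)+\mathcal{B}([y,z],x)+\mathcal{B}([z,x],y)=0$ ($\mathcal B$ is a commutative $2$-cocycle on $(A,[-,-])$) for all $x,y,z\in A$. An anti-pre-Lie algebra is a pair $(A,\circ)$ with a binary operation $\circ$ such that, with $[x,y]=x\circ y-y\circ x$, one has $x\circ(y\circ z)-y\circ(x\circ z)=[y,x]\circ z$ and $[x,y]\circ z+[y,z]\circ x+[z,x]\circ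 y=0$ for all $x,y,z$. Then $(A,[-,-])$ is a Lie algebra, the sub-adjacent Lie algebra of $(A,\circ)$. A relative PCA algebra is a tuple $(A,\cdot,\circ,P,Q)$ where $(A,\cdot)$ is a commutative associative algebra, $(A,\circ)$ is an anti-pre-Lie algebra with sub-adjacent Lie algebra $(A,[-,-])$, $P,Q:A\to A$ are linear maps, $(A,\cdot,[-,-],P)$ is a relative Poisson algebra, and for all $x,y,z\in A$: $x\cdot Q(y)-P(x)\cdot y-Q(x\cdot y)=0$; $x\circ Q(y)-P(x)\circ y-Q(x\circ y)=0$; $x\cdot(y\circ z)-y\circ(x\cdot z)+[x,y]\cdot z-x\cdot P(y)\cdot z=0$; $(x\cdot y)\circ z-y\circ(x\cdot z)-x\circ(y\cdot z)+Q(x\cdot y\cdot z)=0$. It is known (and may be used) that if $\mathcal B$ is a nondegenerate commutative $2$-cocycle on a Lie algebra $(A,[-,-])$, then $\circ$ defined by $\mathcal{B}(x\circ y,z)=\mathcal{B}(y,[x,z])$ is an anti-pre-Lie algebra structure whose sub-adjacent Lie algebra is $(A,[-,-])$. *)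

theory Defs
  imports Complex_Main "HOL-Computational_Algebra.Polynomial"
begin

section \<open>Algebras on a finite-dimensional vector space\<close>

locale fd_vector_space = vector_space scale
  for scale :: "'k::{alg_closed_field, field_char_0} \<Rightarrow> 'a::ab_group_add \<Rightarrow> 'a" +
  assumes finite_dim: "\<exists>Basis. finite_dimensional_vector_space scale Basis"

definition bilinear_map ::
    "('k::field \<Rightarrow> 'a::ab_group_add \<Rightarrow> 'a) \<Rightarrow> ('k \<Rightarrow> 'b::ab_group_add \<Rightarrow> 'b) \<Rightarrow> ('a \<Rightarrow> 'a \<Rightarrow> 'b) \<Rightarrow> bool"
  where "bilinear_map s t f \<longleftrightarrow>
    (\<forall>x. Vector_Spaces.linear s t (\<lambda>y. f x y)) \<and> (\<forall>y. Vector_Spaces.linear s t (\<lambda>x. f x y))"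

text \<open>No unit is required.\<close>
locale comm_assoc_algebra = fd_vector_space scale
  for scale :: "'k::{alg_closed_field, field_char_0} \<Rightarrow> 'a::ab_group_add \<Rightarrow> 'a" +
  fixes mult :: "'a \<Rightarrow> 'a \<Rightarrow> 'a" (infixl \<open>\<cdot>\<close> 70)
  assumes mult_bilinear: "bilinear_map scale scale mult"
    and mult_comm: "x \<cdot> y = y \<cdot> x"
    and mult_assoc: "(x \<cdot> y) \<cdot> z = x \<cdot> (y \<cdot> z)"

locale lie_algebra = fd_vector_space scale
  for scale :: "'k::{alg_closed_field, field_char_0} \<Rightarrow> 'a::ab_group_add \<Rightarrow> 'a" +
  fixes br :: "'a \<Rightarrow> 'a \<Rightarrow> 'a"
  assumes br_bilinear: "bilinear_map scale scale br"
    and br_alternating: "br x x = 0"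
    and jacobi: "br x (br y z) + br y (br z x) + br z (br x y) = 0"

definition derivation ::
    "('k::field \<Rightarrow> 'a::ab_group_add \<Rightarrow> 'a) \<Rightarrow> ('a \<Rightarrow> 'a \<Rightarrow> 'a) \<Rightarrow> ('a \<Rightarrow> 'a) \<Rightarrow> bool"
  where "derivation scale f D \<longleftrightarrow>
    Vector_Spaces.linear scale scale D \<and> (\<forall>x y. D (f x y) = f (D x) y + f x (D y))"

locale relative_poisson_algebra =
  comm_assoc_algebra scale mult + lie_algebra scale br
  for scale :: "'k::{alg_closed_field, field_char_0} \<Rightarrow> 'a::ab_group_add \<Rightarrow> 'a"
    and mult :: "'a \<Rightarrow> 'a \<Rightarrow> 'a" (infixl \<open>\<cdot>\<close> 70)
    and br :: "'a \<Rightarrow> 'a \<Rightarrow> 'a" +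
  fixes P :: "'a \<Rightarrow> 'a"
  assumes P_derivation_mult: "derivation scale mult P"
    and P_derivation_br: "derivation scale br P"
    and relative_leibniz: "br z (x \<cdot> y) = br z x \<cdot> y + x \<cdot> br z y + x \<cdot> y \<cdot> P z"

definition commutator :: "('a::ab_group_add \<Rightarrow> 'a \<Rightarrow> 'a) \<Rightarrow> 'a \<Rightarrow> 'a \<Rightarrow> 'a"
  where "commutator circ x y = circ x y - circ y x"

locale anti_pre_lie_algebra = fd_vector_space scale
  for scale :: "'k::{alg_closed_field, field_char_0} \<Rightarrow> 'a::ab_group_add \<Rightarrow> 'a" +
  fixes circ :: "'a \<Rightarrow> 'a \<Rightarrow> 'a" (infixl \<open>\<odot>\<close> 70)
  assumes circ_bilinear: "bilinear_map scale scale circ"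
    and anti_pre_lie: "x \<odot> (y \<odot> z) - y \<odot> (x \<odot> z) = commutator circ y x \<odot> z"
    and commutator_cyclic:
      "commutator circ x y \<odot> z + commutator circ y z \<odot> x + commutator circ z x \<odot> y = 0"

locale relative_PCA_algebra =
  comm_assoc_algebra scale mult + anti_pre_lie_algebra scale circ +
  relative_poisson_algebra scale mult "commutator circ" P
  for scale :: "'k::{alg_closed_field, field_char_0} \<Rightarrow> 'a::ab_group_add \<Rightarrow> 'a"
    and mult :: "'a \<Rightarrow> 'a \<Rightarrow> 'a" (infixl \<open>\<cdot>\<close> 70)
    and circ :: "'a \<Rightarrow> 'a \<Rightarrow> 'a" (infixl \<open>\<odot>\<close> 70)
    and P :: "'a \<Rightarrow> 'a" +
  fixes Q :: "'a \<Rightarrow> 'a"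
  assumes Q_linear: "Vector_Spaces.linear scale scale Q"
    and mult_PQ: "x \<cdot> Q y - P x \<cdot> y - Q (x \<cdot> y) = 0"
    and circ_PQ: "x \<odot> Q y - P x \<odot> y - Q (x \<odot> y) = 0"
    and mult_circ_P:
      "x \<cdot> (y \<odot> z) - y \<odot> (x \<cdot> z) + commutator circ x y \<cdot> z - x \<cdot> P y \<cdot> z = 0"
    and mult_circ_Q:
      "(x \<cdot> y) \<odot> z - y \<odot> (x \<cdot> z) - x \<odot> (y \<cdot> z) + Q (x \<cdot> y \<cdot> z) = 0"

section \<open>Invariant forms and the operations they induce\<close>

locale nondegenerate_symmetric_form = fd_vector_space scale
  for scale :: "'k::{alg_closed_field, field_char_0} \<Rightarrow> 'a::ab_group_add \<Rightarrow> 'a" +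
  fixes B :: "'a \<Rightarrow> 'a \<Rightarrow> 'k"
  assumes form_bilinear: "bilinear_map scale (*) B"
    and form_symmetric: "B x y = B y x"
    and form_nondegenerate: "(\<And>y. B x y = 0) \<Longrightarrow> x = 0"

locale invariant_c2c_form = nondegenerate_symmetric_form scale B
  for scale :: "'k::{alg_closed_field, field_char_0} \<Rightarrow> 'a::ab_group_add \<Rightarrow> 'a"
    and mult :: "'a \<Rightarrow> 'a \<Rightarrow> 'a" (infixl \<open>\<cdot>\<close> 70)
    and br :: "'a \<Rightarrow> 'a \<Rightarrow> 'a"
    and B :: "'a \<Rightarrow> 'a \<Rightarrow> 'k" +
  assumes form_invariant: "B (x \<cdot> y) z = B x (y \<cdot> z)"
    and form_cocycle: "B (br x y) z + B (br y z) x + B (br z x) y = 0"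

text \<open>
  The descriptions below are proper for a nondegenerate symmetric form \<open>B\<close>, a bilinear \<open>br\<close> and
  a linear \<open>P\<close>; see \<open>induced_circ_ex1\<close> and \<open>form_adjoint_ex1\<close> and the defining equations
  after them.
\<close>

definition induced_circ ::
    "('a \<Rightarrow> 'a \<Rightarrow> 'a) \<Rightarrow> ('a \<Rightarrow> 'a \<Rightarrow> 'k) \<Rightarrow> 'a \<Rightarrow> 'a \<Rightarrow> 'a"
  where "induced_circ br B x y = (THE w. \<forall>z. B w z = B y (br x z))"

definition form_adjoint :: "('a \<Rightarrow> 'a \<Rightarrow> 'k) \<Rightarrow> ('a \<Rightarrow> 'a) \<Rightarrow> 'a \<Rightarrow> 'a"
  where "form_adjoint B P x = (THE w. \<forall>y. B w y = B x (P y))"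

context nondegenerate_symmetric_form
begin

lemma form_linear_right: "Vector_Spaces.linear scale (*) (B x)"
  and form_linear_left: "Vector_Spaces.linear scale (*) (\<lambda>x. B x y)"
  using form_bilinear by (simp_all add: bilinear_map_def)

lemma functional_represented:
  assumes f: "Vector_Spaces.linear scale (*) f"
  shows "\<exists>!w. \<forall>y. B w y = f y"
proof -
  obtain Bs where "finite_dimensional_vector_space scale Bs"
    using finite_dim by blast
  then interpret fd: finite_dimensional_vector_space scale Bs .
  interpret pr: finite_dimensional_vector_space_pair scale Bs scale Bs ..
  interpret ks: vector_space "(*) :: 'k \<Rightarrow> 'k \<Rightarrow> 'k"
    by unfold_locales (simp_all add: algebra_simps)
  interpret pk: vector_space_pair scale "(*) :: 'k \<Rightarrow> 'k \<Rightarrow> 'k" ..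
  have add: "B (x + y) z = B x z + B y z" for x y z
    using module_hom.add[OF form_linear_left[of z, folded module_hom_iff_linear]] .
  have scl: "B (scale c x) z = c * B x z" for c x z
    using module_hom.scale[OF form_linear_left[of z, folded module_hom_iff_linear]] .
  have agree: "B w = g" if g: "Vector_Spaces.linear scale (*) g"
      and eq: "\<And>b. b \<in> Bs \<Longrightarrow> B w b = g b" for w g
    proof
    fix y show "B w y = g y"
      using pk.linear_eq_on[OF form_linear_right[of w] g, of y Bs] eq by (simp add: fd.span_Basis)
  qed
  have zero: "Vector_Spaces.linear scale (*) (\<lambda>_. 0 :: 'k)"
    by (rule pk.linear_zero)
  define T where "T w = (\<Sum>b\<in>Bs. scale (B w b) b)" for w
  have linT: "Vector_Spaces.linear scale scale T"
    by unfold_locales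
      (simp_all add: T_def add scl scale_left_distrib sum.distrib scale_sum_right)
  have coeffs: "\<forall>b\<in>Bs. u b = v b"
    if "(\<Sum>b\<in>Bs. scale (u b) b) = (\<Sum>b\<in>Bs. scale (v b) b)" for u v
  proof -
    have "(\<Sum>b\<in>Bs. scale (u b - v b) b) = 0"
      using that by (simp add: scale_left_diff_distrib sum_subtractf)
    then show ?thesis
      using independentD[OF fd.independent_Basis fd.finite_Basis order_refl, of "\<lambda>b. u b - v b"]
      by simp
  qed
  have "inj T"
  proof (subst pr.linear_inj_iff_eq_0[OF linT], intro allI impI)
    fix w assume "T w = 0"
    then have "\<forall>b\<in>Bs. B w b = 0"
      using coeffs[of "B w" "\<lambda>_. 0"] by (simp add: T_def)
    then have "B w = (\<lambda>_. 0)"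
      using agree[OF zero] by blast
    then show "w = 0" by (intro form_nondegenerate) simp
  qed
  then have "surj T"
    by (rule pr.linear_injective_imp_surjective[OF linT]) simp
  then obtain w where "T w = (\<Sum>b\<in>Bs. scale (f b) b)"
    by (metis surjD)
  then have "B w = f"
    using agree[OF f] coeffs[of "B w" f] by (simp add: T_def)
  moreover have "w' = w" if "B w' = f" for w'
  proof -
    have "B (w' - w) y = 0" for y
      using add[of "w' - w" w y] that \<open>B w = f\<close> by simp
    then show ?thesis using form_nondegenerate by force
  qed
  ultimately have "\<exists>!w. B w = f" by blast
  then show ?thesis by (simp only: fun_eq_iff)
qed

lemma induced_circ_ex1:
  assumes "bilinear_map scale scale br"
  shows "\<exists>!w. \<forall>z. B w z = B y (br x z)"
proof (rule functional_represented)
  have "Vector_Spaces.linear scale scale (br x)"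
    using assms by (simp add: bilinear_map_def)
  from Vector_Spaces.linear_compose[OF this form_linear_right[of y]]
  show "Vector_Spaces.linear scale (*) (\<lambda>z. B y (br x z))" by (simp add: o_def)
qed

lemma induced_circ:
  assumes "bilinear_map scale scale br"
  shows "B (induced_circ br B x y) z = B y (br x z)"
  using theI'[OF induced_circ_ex1[OF assms, of y x]] by (simp add: induced_circ_def)

lemma form_adjoint_ex1:
  assumes "Vector_Spaces.linear scale scale P"
  shows "\<exists>!w. \<forall>y. B w y = B x (P y)"
  using Vector_Spaces.linear_compose[OF assms form_linear_right[of x]]
  by (intro functional_represented) (simp add: o_def)

lemma form_adjoint:
  assumes "Vector_Spaces.linear scale scale P"
  shows "B (form_adjoint B P x) y = B x (P y)"
  using theI'[OF form_adjoint_ex1[OF assms, of x]] by (simp add: form_adjoint_def)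

end

end

theory Submission
  imports Defs
begin

text \<open>
  By nondegeneracy an identity in \<open>A\<close> may be tested against the form. Moving everything to the other
  argument turns each axiom on \<open>induced_circ\<close> and \<open>form_adjoint\<close> into an identity in the relative
  Poisson algebra: the Jacobi identity, one of the two derivation rules for \<open>P\<close>, or the
  relative Leibniz rule. The exception is the cyclic identity of the anti-pre-Lie algebra, which
  needs an antisymmetrisation over four elements.
\<close>

context fd_vector_space
begin

lemma linear_iff:
  "Vector_Spaces.linear scale scale f \<longleftrightarrow>
    (\<forall>x y. f (x + y) = f x + f y) \<and> (\<forall>c x. f (scale c x) = scale c (f x))"
  using vector_space_axioms
  by (auto simp: Vector_Spaces.linear_def module_hom_def module_hom_axioms_def module_iff_vector_space)

lemma bilinear_mapD:
  assumes "bilinear_map scale scale f"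
  shows "f (x + y) z = f x z + f y z" "f z (x + y) = f z x + f z y"
    and "f (scale c x) z = scale c (f x z)" "f z (scale c x) = scale c (f z x)"
    and "f (- x) z = - f x z" "f z (- x) = - f z x"
proof -
  have l: "\<And>y. Vector_Spaces.linear scale scale (f y)"
    and r: "\<And>y. Vector_Spaces.linear scale scale (\<lambda>x. f x y)"
    using assms by (simp_all add: bilinear_map_def)
  show "f (x + y) z = f x z + f y z" "f z (x + y) = f z x + f z y"
    "f (scale c x) z = scale c (f x z)" "f z (scale c x) = scale c (f z x)"
    using l r unfolding linear_iff by blast+
  show "f (- x) z = - f x z" "f z (- x) = - f z x"
    using module_hom.neg[OF r[folded module_hom_iff_linear]]
      module_hom.neg[OF l[folded module_hom_iff_linear]] by blast+
qed

end

context lie_algebra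
begin

lemma br_anti: "br x y = - br y x"
proof -
  have "0 = br (x + y) (x + y)" by (simp add: br_alternating)
  also have "\<dots> = br x y + br y x"
    using br_alternating[of x] br_alternating[of y] by (simp add: bilinear_mapD[OF br_bilinear])
  finally show ?thesis by (simp add: eq_neg_iff_add_eq_0)
qed

lemma jacobi_left: "br (br x y) z = br x (br y z) - br y (br x z)"
proof -
  have "br x (br y z) = - (br y (br z x) + br z (br x y))"
    using jacobi[of x y z] by (metis add.assoc eq_neg_iff_add_eq_0)
  moreover have "br y (br x z) = - br y (br z x)"
    using br_anti[of x z] by (simp add: bilinear_mapD[OF br_bilinear])
  ultimately show ?thesis using br_anti[of "br x y" z] by simp
qed

lemma jacobi_cyclic: "br (br x y) z + br (br y z) x + br (br z x) y = 0"
proof -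
  have "br (br x y) z + br (br y z) x + br (br z x) y =
      - (br x (br y z) + br y (br z x) + br z (br x y))"
    by (simp add: br_anti[of "br x y" z] br_anti[of "br y z" x] br_anti[of "br z x" y])
  then show ?thesis by (simp only: jacobi minus_zero)
qed

end

context nondegenerate_symmetric_form
begin

lemma form_simps:
  "B (x + y) z = B x z + B y z" "B x (y + z) = B x y + B x z"
  "B (- x) y = - B x y" "B x (- y) = - B x y"
  "B (x - y) z = B x z - B y z" "B x (y - z) = B x y - B x z"
  "B (scale c x) y = c * B x y" "B x (scale c y) = c * B x y"
  "B 0 x = 0" "B x 0 = 0"
  using form_linear_left[folded module_hom_iff_linear] form_linear_right[folded module_hom_iff_linear]
  by (auto dest: module_hom.add module_hom.scale module_hom.neg module_hom.diff module_hom.zero)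

lemma form_eqI: "(\<And>z. B x z = B y z) \<Longrightarrow> x = y"
  using form_nondegenerate[of "x - y"] by (simp add: form_simps)

lemma linear_form_adjoint:
  assumes "Vector_Spaces.linear scale scale P"
  shows "Vector_Spaces.linear scale scale (form_adjoint B P)"
  unfolding linear_iff by (auto intro!: form_eqI simp: form_adjoint[OF assms] form_simps)

lemma bilinear_induced_circ:
  assumes "bilinear_map scale scale br"
  shows "bilinear_map scale scale (induced_circ br B)"
  unfolding bilinear_map_def linear_iff
  by (auto intro!: form_eqI simp: induced_circ[OF assms] form_simps bilinear_mapD[OF assms])

end

text \<open>The setting of the known fact that a nondegenerate commutative 2-cocycle on a Lie
  algebra yields an anti-pre-Lie structure; that fact is proved here.\<close>

locale lie_algebra_with_c2c_form = lie_algebra scale br + nondegenerate_symmetric_form scale B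
  for scale :: "'k::{alg_closed_field, field_char_0} \<Rightarrow> 'a::ab_group_add \<Rightarrow> 'a" and br B +
  assumes cocycle: "B (br x y) z + B (br y z) x + B (br z x) y = 0"
begin

lemmas circ = induced_circ[OF br_bilinear]

text \<open>Moving both products across the form leaves the cocycle condition, up to the symmetry of
  \<open>B\<close> and the antisymmetry of \<open>br\<close>.\<close>

lemma commutator_induced_circ: "commutator (induced_circ br B) = br"
proof (intro ext form_eqI)
  fix x y z
  show "B (commutator (induced_circ br B) x y) z = B (br x y) z"
    using cocycle[of x y z] br_anti[of z x] form_symmetric[of x "br y z"]
      form_symmetric[of y "br x z"]
    by (simp add: commutator_def circ form_simps) (simp add: algebra_simps add_eq_0_iff)
qed

text \<open>Sum the cocycle condition for \<open>br x y\<close>, \<open>w\<close>, \<open>z\<close>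
  over the cyclic shifts of \<open>x\<close>, \<open>y\<close>, \<open>z\<close>; the terms paired
  with \<open>w\<close> add up to zero by Jacobi.\<close>

lemma form_double_br_cyclic:
  "B (br (br x y) w) z + B (br (br y z) w) x + B (br (br z x) w) y =
    - (B (br w z) (br x y) + B (br w x) (br y z) + B (br w y) (br z x))"
proof -
  have "B (br z (br x y)) w + B (br x (br y z)) w + B (br y (br z x)) w = 0"
    using arg_cong[OF jacobi[of x y z], of "\<lambda>v. B v w"] by (simp add: form_simps algebra_simps)
  with cocycle[of "br x y" w z] cocycle[of "br y z" w x] cocycle[of "br z x" w y]
  show ?thesis by algebra
qed

text \<open>
  The left-hand side \<open>S\<close> is alternating in its four arguments. Subtracting from
  \<open>form_double_br_cyclic\<close> its variants with \<open>w\<close> exchanged for \<open>x\<close>, \<open>y\<close> and \<open>z\<close> therefore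
  leaves \<open>- 4 S\<close> on the right, while the double brackets cancel by the Jacobi identity.
\<close>
lemma form_br_br_cyclic:
  "B (br w z) (br x y) + B (br w x) (br y z) + B (br w y) (br z x) = 0"
  (is "?S w x y z = 0")
proof -
  have anti: "B (br (br a b) c) d = - B (br (br b a) c) d" for a b c d
    using br_anti[of a b] by (simp add: bilinear_mapD[OF br_bilinear] form_simps)
  have swap: "?S z x y w = - ?S w x y z" "?S x w y z = - ?S w x y z" "?S y x w z = - ?S w x y z"
    by (simp_all add: br_anti[of z w] br_anti[of x w] br_anti[of y w]
        br_anti[of y x] br_anti[of z y] br_anti[of x z] form_simps)
      (simp_all add: form_symmetric algebra_simps)
  \<comment> \<open>Sorted by the second argument of \<open>B\<close>, the twelve double brackets
    form four Jacobi sums, one for each instance of \<open>J\<close> below; \<open>anti\<close>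
    adjusts their signs.\<close>
  have J: "B (br (br x y) z) w + B (br (br y z) x) w + B (br (br z x) y) w = 0" for x y z w
    using arg_cong[OF jacobi_cyclic[of x y z], of "\<lambda>v. B v w"] by (simp add: form_simps)
  have "4 * ?S w x y z = 0"
    using form_double_br_cyclic[of x y w z] form_double_br_cyclic[of x y z w]
      form_double_br_cyclic[of w y x z] form_double_br_cyclic[of x w y z] swap
      J[of x y w z] J[of y z w x] J[of z x w y] J[of x y z w]
      anti[of w y x z] anti[of x w y z] anti[of y w z x] anti[of w z y x]
      anti[of w x z y] anti[of z w x y]
    by algebra
  \<comment> \<open>Characteristic zero makes 4 invertible.\<close>
  then show ?thesis by (simp only: mult_eq_0_iff) simp
qed

text \<open>Left multiplication by \<open>x\<close> is the transpose of \<open>br x\<close>.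
  Transposition reverses composition, so the Jacobi identity gives the first axiom with
  \<open>br y x\<close> in place of \<open>br x y\<close>.\<close>

lemma anti_pre_lie_algebra_induced_circ: "anti_pre_lie_algebra scale (induced_circ br B)"
proof (unfold_locales, unfold commutator_induced_circ)
  fix x y z
  let ?c = "induced_circ br B"
  show "bilinear_map scale scale ?c" by (rule bilinear_induced_circ[OF br_bilinear])
  show "?c x (?c y z) - ?c y (?c x z) = ?c (br y x) z"
    by (rule form_eqI) (simp add: circ form_simps jacobi_left)
  show "?c (br x y) z + ?c (br y z) x + ?c (br z x) y = 0"
  proof (rule form_eqI)
    fix w
    \<comment> \<open>Pairing with \<open>w\<close> produces the double brackets of
      \<open>form_double_br_cyclic\<close>, whose other side vanishes by
      \<open>form_br_br_cyclic\<close>.\<close>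
    show "B (?c (br x y) z + ?c (br y z) x + ?c (br z x) y) w = B 0 w"
      using form_double_br_cyclic[of x y w z] form_br_br_cyclic[of w z x y]
      by (simp add: circ form_simps form_symmetric[of _ "br (br _ _) _"])
  qed
qed

end

theorem proposition2p21:
  fixes scale :: "'k::{alg_closed_field, field_char_0} \<Rightarrow> 'a::ab_group_add \<Rightarrow> 'a"
    and mult br :: "'a \<Rightarrow> 'a \<Rightarrow> 'a"
    and P :: "'a \<Rightarrow> 'a"
    and B :: "'a \<Rightarrow> 'a \<Rightarrow> 'k"
  assumes "relative_poisson_algebra scale mult br P"
    and "invariant_c2c_form scale mult br B"
  shows "relative_PCA_algebra scale mult (induced_circ br B) P (form_adjoint B P)"
proof -
  interpret relative_poisson_algebra scale mult br P by fact
  interpret f: invariant_c2c_form scale mult br B by fact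
  interpret c: lie_algebra_with_c2c_form scale br B
    by unfold_locales (rule f.form_cocycle)
  interpret anti_pre_lie_algebra scale "induced_circ br B"
    by (rule c.anti_pre_lie_algebra_induced_circ)
  let ?c = "induced_circ br B" and ?Q = "form_adjoint B P"
  have P: "Vector_Spaces.linear scale scale P"
    and P_mult: "\<And>x y. P (mult x y) = mult (P x) y + mult x (P y)"
    and P_br: "\<And>x y. P (br x y) = br (P x) y + br x (P y)"
    using P_derivation_mult P_derivation_br by (simp_all add: derivation_def)
  \<comment> \<open>Multiplication by \<open>x\<close> is self-adjoint; in this orientation
    rewriting gathers all factors in the second argument.\<close>
  have move: "B (mult x y) z = B y (mult x z)" for x y z
    using f.form_invariant[of y x z] by (simp add: mult_comm)
  note adj = f.form_adjoint[OF P] c.circ f.form_simps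
  note mb = bilinear_mapD[OF mult_bilinear]
  have comm: "commutator ?c = br" by (rule c.commutator_induced_circ)
  show ?thesis
  proof (intro relative_PCA_algebra.intro relative_PCA_algebra_axioms.intro, unfold comm)
    fix x y z
    show "comm_assoc_algebra scale mult" "anti_pre_lie_algebra scale ?c"
      "relative_poisson_algebra scale mult br P"
      by unfold_locales
    show "Vector_Spaces.linear scale scale ?Q" by (rule f.linear_form_adjoint[OF P])
    show "mult x (?Q y) - mult (P x) y - ?Q (mult x y) = 0"
      by (rule f.form_eqI) (simp add: move adj P_mult)
    show "?c x (?Q y) - ?c (P x) y - ?Q (?c x y) = 0"
      by (rule f.form_eqI) (simp add: adj P_br)
    show "mult x (?c y z) - ?c y (mult x z) + mult (br x y) z - mult (mult x (P y)) z = 0"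
    proof (rule f.form_eqI)
      fix w
      \<comment> \<open>The goal with every operator on \<open>z\<close> transposed onto
        \<open>w\<close>: the relative Leibniz rule for \<open>br y (mult x w)\<close>.\<close>
      have "br y (mult x w) - mult x (br y w) + mult (br x y) w - mult (mult x (P y)) w = 0"
        using br_anti[of x y] by (simp add: relative_leibniz mb mult_assoc mult_comm[of w])
      then have "B z (br y (mult x w) - mult x (br y w) + mult (br x y) w - mult (mult x (P y)) w) = 0"
        by (simp add: f.form_simps)
      then show "B (mult x (?c y z) - ?c y (mult x z) + mult (br x y) z - mult (mult x (P y)) z) w = B 0 w"
        by (simp add: move adj)
    qed
    show "?c (mult x y) z - ?c y (mult x z) - ?c x (mult y z) + ?Q (mult (mult x y) z) = 0"
    proof (rule f.form_eqI)
      fix w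
      \<comment> \<open>Here the Leibniz rule expands \<open>br w (mult x y)\<close>; its term with
        \<open>P w\<close> is the transpose of the one with \<open>?Q\<close>.\<close>
      have "br (mult x y) w - mult x (br y w) - mult y (br x w) + mult (mult x y) (P w) = 0"
        using br_anti[of "mult x y" w] br_anti[of x w] br_anti[of y w]
        by (simp add: relative_leibniz mb mult_comm[of y])
      then have "B z (br (mult x y) w - mult x (br y w) - mult y (br x w) + mult (mult x y) (P w)) = 0"
        by (simp add: f.form_simps)
      then show "B (?c (mult x y) z - ?c y (mult x z) - ?c x (mult y z) + ?Q (mult (mult x y) z)) w = B 0 w"
        by (simp add: move adj)
    qed
  qed
qed

end
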